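(* Let $n>1$. The set $\mathcal{SL}(n)$ of semi-Lucas partitions consists of all partitions $\lambda=(\lambda_1,\ldots,\lambda_{\ell(\lambda)})$ of $n$ satisfying the following conditions: (a) $v_i(\lambda)$ has odd multiplicity in $v(\lambda)$ for all $1\leq i\leq \ell(\lambda)$; (b) $\lambda_i\in \{2^k \mid k \in \mathbb Z_{\geq 0}\}$ for all $1<i\leq \ell(\lambda)$; (c) $\lambda_1\in \{2^k, 3\cdot 2^k \mid k \in \mathbb Z_{\geq 0}\}$; (d) $\lambda_1$ has the largest $2$-adic valuation among the parts of $\lambda$ (i.e. the $2$-adic valuation of $\lambda_1$ is at least that of every part of $\lambda$).
   Context: A partition of $n$ is a weakly decreasing sequence $\lambda_1\ge\lambda_2\ge\cdots$ (equivalently, a finite multiset) of positive integers with sum $n$; $\ell(\lambda)$ is its number of parts. $v(\lambda)=(v_1(\lambda),\ldots,v_{\ell(\lambda)}(\lambda))$ is the sequence obtained by arranging the $2$-adic valuations of the parts of $\lambda$ (with repetition) in non-increasing order; multiplicity in $v(\lambda)$ is the number of occurrences in this sequence. $\lambda\sqcup\mu$ is the partition whose multiset of parts is the multiset union (multiplicities added) of the parts of $\lambda$ and $\mu$; $2\lambda$ is obtained by doubling every part of $\lambda$; these operations are applied elementwise to sets of partitions. The semi-Lucas partitions are defined recursively by $\mathcal{SL}(2)=\{(2)\}$, $\mathcal{SL}(3)=\{(3),(2,1),(1,1,1)\}$, and for $n>1$: $\mathcal{SL}(2n)=2\,\mathcal{SL}(n)$ and $\mathcal{SL}(2n+1)=\big(\mathcal{SL}(2n)\sqcup(1)\big)\cup\big(\mathcal{SL}(2n-1)\sqcup(1,1)\big)$.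 *)

theory Defs
  imports "HOL-Library.Multiset" "HOL-Computational_Algebra.Primes"
begin

text \<open>Partitions are represented by the finite multisets of their parts, so that the union
  \<open>\<lambda> \<squnion> \<mu>\<close>, with multiplicities added, is the multiset sum \<open>\<lambda> + \<mu>\<close>, and the number of parts
  \<open>\<ell>(\<lambda>)\<close> is \<open>size \<lambda>\<close>.\<close>

definition partitions :: "nat \<Rightarrow> nat multiset set" where
  "partitions n = {la. (\<forall>x\<in>#la. x > 0) \<and> \<Sum>\<^sub># la = n}"

text \<open>\<open>part \<lambda> i\<close> and \<open>val \<lambda> i\<close> are \<open>\<lambda>\<^sub>i\<close> and \<open>v\<^sub>i(\<lambda>)\<close>; the index starts at \<open>1\<close> and the values
  are meaningful only for \<open>1 \<le> i \<le> size \<lambda>\<close>.\<close>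

definition part :: "nat multiset \<Rightarrow> nat \<Rightarrow> nat" where
  "part la i = rev (sorted_list_of_multiset la) ! (i - 1)"

definition val_seq :: "nat multiset \<Rightarrow> nat list" where
  "val_seq la = rev (sorted_list_of_multiset (image_mset (multiplicity 2) la))"

definition val :: "nat multiset \<Rightarrow> nat \<Rightarrow> nat" where
  "val la i = val_seq la ! (i - 1)"

definition double :: "nat multiset \<Rightarrow> nat multiset" where
  "double la = image_mset (\<lambda>x. 2 * x) la"

text \<open>The semi-Lucas partitions are defined for \<open>n \<ge> 2\<close> only; the value for \<open>n < 2\<close> is a dummy
  that the other equations never refer to.\<close>

function SL :: "nat \<Rightarrow> nat multiset set" where
  "n < 2 \<Longrightarrow> SL n = {}"
| "SL 2 = {{#2#}}"
| "SL 3 = {{#3#}, {#2, 1#}, {#1, 1, 1#}}"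
| "n > 1 \<Longrightarrow> SL (2 * n) = double ` SL n"
| "n > 1 \<Longrightarrow> SL (2 * n + 1) =
     (\<lambda>la. la + {#1#}) ` SL (2 * n) \<union> (\<lambda>la. la + {#1, 1#}) ` SL (2 * n - 1)"
  by (atomize_elim, presburger) ((rule FalseE, presburger) | simp)+
termination by (relation "measure id") auto

end

theory Submission
  imports Defs
begin

text \<open>Both sides of the theorem satisfy the same recursion on \<open>n\<close>.

  This becomes visible once the order of the parts is forgotten. Condition (c) gives
  \<open>\<lambda>\<^sub>1 = c * 2 ^ k\<close> with \<open>c \<in> {1, 3}\<close>, and (b) and (d) say that every other part is a power
  \<open>2 ^ j\<close> with \<open>j \<le> k\<close>. Such a power is at most \<open>c * 2 ^ k\<close>, so a part that dominates the
  others in this sense is automatically a largest one, and (b)--(d) together just say that \<open>\<lambda>\<close>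
  has \<^emph>\<open>some\<close> dominating part (\<open>lucas_conditions_iff\<close>). Condition (a) is a statement about the
  multiset of valuations (\<open>odd_count_list_iff_odd_mults\<close>).

  The number of parts of valuation \<open>0\<close> has the parity of \<open>n\<close>. If \<open>n\<close> is even, then (a) forces this
  number to be \<open>0\<close>, so all parts are even and the partition is the double of a partition of
  \<open>n div 2\<close>, which satisfies the same conditions (\<open>Lucas_even\<close>). If \<open>n\<close> is odd, the number of odd
  parts is odd. When it is at least \<open>3\<close>, at least two of these parts are not the dominating one and
  therefore equal \<open>1\<close>; removing two ones keeps the number odd, so (a) survives. When it is \<open>1\<close>, the
  odd part is either a removable \<open>1\<close>, or the dominating part itself; in the latter case domination
  leaves room for no other part, and the partition is \<open>(1)\<close> or \<open>(3)\<close> (\<open>Lucas_odd\<close>). The partition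
  \<open>(3)\<close> is what the initial value \<open>SL 3\<close> adds to the recursion.\<close>

section \<open>Multisets in which every multiplicity is odd\<close>

definition odd_mults :: "'a multiset \<Rightarrow> bool" where
  "odd_mults M \<longleftrightarrow> (\<forall>e\<in>#M. odd (count M e))"

lemma odd_mults_add_new:
  assumes "e \<notin># M"
  shows "odd_mults (add_mset e M) \<longleftrightarrow> odd_mults M"
proof -
  have "count M e = 0" using assms by (simp add: not_in_iff)
  moreover have "x \<noteq> e" if "x \<in># M" for x using assms that by blast
  ultimately show ?thesis unfolding odd_mults_def by fastforce
qed

lemma odd_mults_add_twice:
  assumes "e \<in># M"
  shows "odd_mults (add_mset e (add_mset e M)) \<longleftrightarrow> odd_mults M"
  using assms unfolding odd_mults_def by auto

lemma count_image_mset_inj_on_all: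
  assumes "inj f"
  shows "count (image_mset f M) (f x) = count M x"
  by (induction M) (use assms in \<open>auto simp: inj_eq\<close>)

lemma odd_mults_image_inj:
  assumes "inj f"
  shows "odd_mults (image_mset f M) \<longleftrightarrow> odd_mults M"
  using assms unfolding odd_mults_def by (auto simp: count_image_mset_inj_on_all)

section \<open>The conditions without reference to the order of the parts\<close>

abbreviation vals :: "nat multiset \<Rightarrow> nat multiset" where
  "vals la \<equiv> image_mset (multiplicity 2) la"

text \<open>The factor \<open>c\<close> is what makes doubling transparent: it changes only the exponent \<open>k\<close>.\<close>

definition dominated :: "nat multiset \<Rightarrow> bool" where
  "dominated la \<longleftrightarrow> (\<exists>c k mu. la = add_mset (c * 2 ^ k) mu \<and> (c = 1 \<or> c = 3) \<and>
     (\<forall>x\<in>#mu. \<exists>j\<le>k. x = 2 ^ j))"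

lemma dominatedI:
  assumes "c = 1 \<or> c = 3" "\<forall>x\<in>#mu. \<exists>j\<le>k. x = 2 ^ j"
  shows "dominated (add_mset (c * 2 ^ k) mu)"
  unfolding dominated_def by (rule exI, rule exI, rule exI, rule conjI[OF refl]) (use assms in simp)

lemma multiplicity_two_dominating:
  assumes "c = 1 \<or> c = 3"
  shows "multiplicity 2 (c * 2 ^ k :: nat) = k"
proof (rule multiplicity_eqI)
  have "odd c" using assms by auto
  thus "\<not> 2 ^ Suc k dvd c * 2 ^ k" by simp
qed simp

lemma multiplicity_two_power [simp]: "multiplicity 2 (2 ^ k :: nat) = k"
  using multiplicity_two_dominating[of 1 k] by simp

lemma dominated_singleton:
  assumes "c = 1 \<or> c = 3"
  shows "dominated {#c#}"
  using dominatedI[OF assms, of "{#}" 0] by simp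

lemma dominated_append_one: "dominated la \<Longrightarrow> dominated (add_mset 1 la)"
proof -
  assume "dominated la"
  then obtain c k mu where *: "la = add_mset (c * 2 ^ k) mu" "c = 1 \<or> c = 3"
      "\<forall>x\<in>#mu. \<exists>j\<le>k. x = 2 ^ j"
    unfolding dominated_def by blast
  have "add_mset 1 la = add_mset (c * 2 ^ k) (add_mset 1 mu)"
    using *(1) by (simp add: add_mset_commute)
  moreover have "\<forall>x\<in>#add_mset 1 mu. \<exists>j\<le>k. x = 2 ^ j"
    using *(3) by (auto intro: exI[of _ 0])
  ultimately show ?thesis
    using *(2) unfolding dominated_def by blast
qed

lemma odd_count_list_iff_odd_mults:
  "(\<forall>i\<in>{1..size la}. odd (count_list (val_seq la) (val la i))) \<longleftrightarrow> odd_mults (vals la)"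
proof -
  have m: "mset (val_seq la) = vals la"
    by (simp add: val_seq_def)
  have len: "length (val_seq la) = size la"
    using arg_cong[OF m, of size] by simp
  have "(\<forall>i\<in>{1..size la}. odd (count_list (val_seq la) (val la i))) \<longleftrightarrow>
        (\<forall>i<size la. odd (count_list (val_seq la) (val_seq la ! i)))"
    (is "?l \<longleftrightarrow> ?r")
  proof
    assume ?l
    show ?r
    proof safe
      fix i assume "i < size la"
      hence "Suc i \<in> {1..size la}" by simp
      from \<open>?l\<close>[rule_format, OF this] show "even (count_list (val_seq la) (val_seq la ! i)) \<Longrightarrow> False"
        by (simp add: val_def)
    qed
  qed (auto simp: val_def)
  also have "\<dots> \<longleftrightarrow> (\<forall>e\<in>set (val_seq la). odd (count_list (val_seq la) e))"
    by (simp add: all_set_conv_all_nth len)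
  also have "\<dots> \<longleftrightarrow> odd_mults (vals la)"
    unfolding odd_mults_def m[symmetric] by (simp add: count_mset)
  finally show ?thesis .
qed

text \<open>The direction from right to left has to identify the first part: every \<open>2 ^ j\<close> with \<open>j \<le> k\<close>
  is bounded by \<open>c * 2 ^ k\<close>, so a dominating part is a maximal element and hence \<open>\<lambda>\<^sub>1\<close>.\<close>

lemma lucas_conditions_iff:
  assumes "la \<noteq> {#}"
  shows "((\<forall>i\<in>{1<..size la}. part la i \<in> {2 ^ k | k. True}) \<and>
      part la 1 \<in> {2 ^ k | k. True} \<union> {3 * 2 ^ k | k. True} \<and>
      (\<forall>i\<in>{1..size la}. multiplicity 2 (part la i) \<le> multiplicity 2 (part la 1)))
    \<longleftrightarrow> dominated la"
    (is "?L \<longleftrightarrow> _")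
proof -
  obtain a ys where xs: "rev (sorted_list_of_multiset la) = a # ys"
    using assms by (metis mset.simps(1) mset_rev mset_sorted_list_of_multiset neq_Nil_conv)
  have la: "la = add_mset a (mset ys)"
    using arg_cong[OF xs, of mset] by simp
  have "sorted (rev (a # ys))"
    by (metis rev_rev_ident sorted_sorted_list_of_multiset xs)
  hence le: "y \<le> a" if "y \<in> set ys" for y
    using that by (auto simp: sorted_append)
  have first: "part la 1 = a"
    by (simp add: part_def xs)
  have rest: "(\<forall>i\<in>{1<..size la}. P (part la i)) \<longleftrightarrow> (\<forall>y\<in>set ys. P y)" for P
  proof -
    have "(\<forall>i\<in>{1<..size la}. P (part la i)) \<longleftrightarrow> (\<forall>i<length ys. P (part la (i + 2)))"
    proof safe
      fix i assume *: "\<forall>i<length ys. P (part la (i + 2))" and i: "i \<in> {1<..size la}"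
      from i have "i - 2 < length ys" "i - 2 + 2 = i" by (auto simp: la)
      thus "P (part la i)" using * by metis
    qed (auto simp: la)
    thus ?thesis by (simp add: part_def xs all_set_conv_all_nth)
  qed
  have split: "{1..size la} = insert 1 {1<..size la}"
    by (auto simp: la)
  have "?L \<longleftrightarrow> (\<forall>y\<in>set ys. (\<exists>j. y = 2 ^ j) \<and> multiplicity 2 y \<le> multiplicity 2 a) \<and>
      ((\<exists>k. a = 2 ^ k) \<or> (\<exists>k. a = 3 * 2 ^ k))"
    unfolding split ball_simps first rest[of "\<lambda>x. x \<in> {2 ^ k | k. True}"]
      rest[of "\<lambda>x. multiplicity 2 x \<le> multiplicity 2 a"] by blast
  also have "\<dots> \<longleftrightarrow> (\<exists>c k. a = c * 2 ^ k \<and> (c = 1 \<or> c = 3) \<and> (\<forall>y\<in>set ys. \<exists>j\<le>k. y = 2 ^ j))"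
    (is "?A \<longleftrightarrow> ?B")
  proof
    assume ?A
    then obtain k where "a = 1 * 2 ^ k \<or> a = 3 * 2 ^ k" by auto
    then obtain c where a: "a = c * 2 ^ k" and c: "c = 1 \<or> c = 3" by blast
    have "\<exists>j\<le>k. y = 2 ^ j" if y: "y \<in> set ys" for y
    proof -
      obtain j where j: "y = 2 ^ j" using \<open>?A\<close> y by blast
      have "multiplicity 2 y \<le> multiplicity 2 a" using \<open>?A\<close> y by blast
      hence "j \<le> k" by (simp add: j a multiplicity_two_dominating[OF c])
      thus ?thesis using j by blast
    qed
    thus ?B using a c by blast
  next
    assume ?B
    then obtain c k where a: "a = c * 2 ^ k" and c: "c = 1 \<or> c = 3"
      and *: "\<forall>y\<in>set ys. \<exists>j\<le>k. y = 2 ^ j" by blast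
    have "(\<exists>j. y = 2 ^ j) \<and> multiplicity 2 y \<le> multiplicity 2 a" if y: "y \<in> set ys" for y
    proof -
      obtain j where "j \<le> k" "y = 2 ^ j" using * y by blast
      thus ?thesis by (auto simp: a multiplicity_two_dominating[OF c])
    qed
    moreover have "(\<exists>k. a = 2 ^ k) \<or> (\<exists>k. a = 3 * 2 ^ k)" using a c by auto
    ultimately show ?A by blast
  qed
  also have "\<dots> \<longleftrightarrow> dominated la"
  proof
    assume "\<exists>c k. a = c * 2 ^ k \<and> (c = 1 \<or> c = 3) \<and> (\<forall>y\<in>set ys. \<exists>j\<le>k. y = 2 ^ j)"
    then obtain c k where a: "a = c * 2 ^ k" and "c = 1 \<or> c = 3"
      and "\<forall>y\<in>set ys. \<exists>j\<le>k. y = 2 ^ j"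
      by (elim exE conjE)
    thus "dominated la"
      unfolding la a by (intro dominatedI) simp_all
  next
    assume "dominated la"
    then obtain c k mu where d: "la = add_mset (c * 2 ^ k) mu" and c: "c = 1 \<or> c = 3"
      and mu: "\<forall>x\<in>#mu. \<exists>j\<le>k. x = 2 ^ j"
      unfolding dominated_def by blast
    have bound: "x \<le> c * 2 ^ k" if x: "x \<in># mu" for x
    proof -
      obtain j where j: "j \<le> k" "x = 2 ^ j" using mu x by blast
      have "1 * 2 ^ j \<le> c * 2 ^ k"
        using j(1) c by (intro mult_le_mono power_increasing) auto
      thus ?thesis by (simp add: j(2))
    qed
    have eq: "add_mset a (mset ys) = add_mset (c * 2 ^ k) mu" using la d by simp
    have "a \<in># add_mset (c * 2 ^ k) mu" by (simp flip: eq)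
    hence "a \<le> c * 2 ^ k" using bound[of a] by auto
    moreover have "c * 2 ^ k \<in># add_mset a (mset ys)" by (simp add: eq)
    hence "c * 2 ^ k \<le> a" using le[of "c * 2 ^ k"] by auto
    ultimately have a: "a = c * 2 ^ k" by (rule antisym)
    hence ys: "mset ys = mu" using eq by simp
    have "\<forall>y\<in>set ys. \<exists>j\<le>k. y = 2 ^ j"
      using mu by (simp flip: ys)
    thus "\<exists>c k. a = c * 2 ^ k \<and> (c = 1 \<or> c = 3) \<and> (\<forall>y\<in>set ys. \<exists>j\<le>k. y = 2 ^ j)"
      by (intro exI conjI) (rule a, rule c)
  qed
  finally show ?thesis .
qed

section \<open>The recursion satisfied by the conditions\<close>

definition Lucas :: "nat \<Rightarrow> nat multiset set" where
  "Lucas n = {la \<in> partitions n. odd_mults (vals la) \<and> dominated la}"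

text \<open>Read modulo \<open>2\<close>, the sum of the parts counts the odd parts. Positivity excludes the part \<open>0\<close>,
  which is even although \<open>multiplicity 2 0 = 0\<close>.\<close>

lemma odd_sum_mset_iff_odd_count:
  assumes "\<forall>x\<in>#la. x > 0"
  shows "odd (\<Sum>\<^sub># la) \<longleftrightarrow> odd (count (vals la) 0)"
  using assms
proof (induction la)
  case (add x la)
  hence "multiplicity 2 x = 0 \<longleftrightarrow> odd x"
    using multiplicity_gt_zero_iff[of x 2] by auto
  with add show ?case by auto
qed simp

lemma vals_double:
  assumes "\<forall>x\<in>#la. x > 0"
  shows "vals (double la) = image_mset Suc (vals la)"
  using assms unfolding double_def multiset.map_comp
  by (intro image_mset_cong) (simp add: multiplicity_times_same)

lemma dominated_double_iff: "dominated (double la) \<longleftrightarrow> dominated la"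
proof
  assume "dominated la"
  then obtain c k mu where *: "la = add_mset (c * 2 ^ k) mu" "c = 1 \<or> c = 3"
      "\<forall>x\<in>#mu. \<exists>j\<le>k. x = 2 ^ j"
    unfolding dominated_def by blast
  have "double la = add_mset (c * 2 ^ Suc k) (double mu)"
    by (simp add: * double_def)
  moreover have "\<forall>x\<in>#double mu. \<exists>j\<le>Suc k. x = 2 ^ j"
    using *(3) unfolding double_def by (auto simp flip: power_Suc)
  ultimately show "dominated (double la)"
    using *(2) unfolding dominated_def by blast
next
  assume "dominated (double la)"
  then obtain c k mu where *: "double la = add_mset (c * 2 ^ k) mu" "c = 1 \<or> c = 3"
      "\<forall>x\<in>#mu. \<exists>j\<le>k. x = 2 ^ j"
    unfolding dominated_def by blast
  obtain la' x where la: "la = add_mset x la'" and x: "2 * x = c * 2 ^ k" and mu: "mu = double la'"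
    using *(1) unfolding double_def by (auto dest!: msed_map_invR)
  \<comment> \<open>The dominating part is even and \<open>c\<close> is odd.\<close>
  have "k \<noteq> 0"
    using x *(2) by (cases k) (auto, presburger)
  then obtain k' where k: "k = Suc k'" using not0_implies_Suc by blast
  have "\<exists>j\<le>k'. y = 2 ^ j" if "y \<in># la'" for y
  proof -
    have "2 * y \<in># mu" using that by (simp add: mu double_def)
    then obtain j where j: "j \<le> k" "2 * y = 2 ^ j"
      using *(3) by blast
    thus ?thesis
      by (cases j) (auto simp: k)
  qed
  moreover have "x = c * 2 ^ k'" using x by (simp add: k)
  ultimately show "dominated la"
    using la *(2) unfolding dominated_def by blast
qed

lemma Lucas_even: "Lucas (2 * m) = double ` Lucas m"
proof
  show "double ` Lucas m \<subseteq> Lucas (2 * m)"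
    unfolding Lucas_def partitions_def
    by (auto simp: dominated_double_iff vals_double odd_mults_image_inj)
       (auto simp: double_def simp flip: sum_mset_distrib_left)
  show "Lucas (2 * m) \<subseteq> double ` Lucas m"
  proof
    fix la assume "la \<in> Lucas (2 * m)"
    hence pos: "\<forall>x\<in>#la. x > 0" and sum: "\<Sum>\<^sub># la = 2 * m"
      and om: "odd_mults (vals la)" and dom: "dominated la"
      unfolding Lucas_def partitions_def by auto
    have "even (count (vals la) 0)"
      using odd_sum_mset_iff_odd_count[OF pos] sum by simp
    hence "0 \<notin># vals la"
      using om unfolding odd_mults_def by blast
    hence even: "\<forall>x\<in>#la. even x"
      using not_dvd_imp_multiplicity_0 by force
    define mu where "mu = image_mset (\<lambda>x. x div 2) la"
    have la: "la = double mu"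
      using image_mset_cong[of la "\<lambda>x. 2 * (x div 2)" "\<lambda>x. x"] even
      unfolding mu_def double_def by (simp add: multiset.map_comp o_def)
    have "\<forall>x\<in>#mu. x > 0" using pos unfolding la double_def by auto
    moreover have "\<Sum>\<^sub># mu = m"
      using sum unfolding la double_def by (simp flip: sum_mset_distrib_left)
    ultimately have "mu \<in> Lucas m"
      using om dom unfolding la Lucas_def partitions_def
      by (simp add: dominated_double_iff vals_double odd_mults_image_inj)
    thus "la \<in> double ` Lucas m" using la by blast
  qed
qed

lemma count_vals_zero_powers:
  assumes "\<forall>x\<in>#mu. \<exists>j\<le>k. x = 2 ^ j"
  shows "count (vals mu) 0 = count mu 1"
  using assms by (induction mu) auto

text \<open>The multiplicity of the valuation \<open>0\<close> is zero or odd, so its parity, which is that of \<open>n\<close>,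
  tells whether \<open>0\<close> occurs. This decides how many ones can be added: a single one is a new
  valuation when \<open>n\<close> is even, while two ones keep an odd multiplicity odd when \<open>n\<close> is odd.\<close>

lemma odd_iff_zero_in_vals:
  assumes "la \<in> Lucas n"
  shows "odd n \<longleftrightarrow> 0 \<in># vals la"
proof -
  have pos: "\<forall>x\<in>#la. x > 0" and sum: "\<Sum>\<^sub># la = n" and om: "odd_mults (vals la)"
    using assms unfolding Lucas_def partitions_def by auto
  have "odd n \<longleftrightarrow> odd (count (vals la) 0)"
    using odd_sum_mset_iff_odd_count[OF pos] sum by simp
  also have "\<dots> \<longleftrightarrow> 0 \<in># vals la"
  proof
    assume "odd (count (vals la) 0)"
    hence "count (vals la) 0 \<noteq> 0" by (intro notI) simp
    thus "0 \<in># vals la" by (simp only: count_eq_zero_iff not_not)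
  next
    assume "0 \<in># vals la"
    thus "odd (count (vals la) 0)" using om unfolding odd_mults_def by (rule bspec[rotated])
  qed
  finally show ?thesis .
qed

lemma Lucas_add_one:
  assumes "la \<in> Lucas (2 * m)"
  shows "add_mset 1 la \<in> Lucas (2 * m + 1)"
proof -
  have "0 \<notin># vals la"
    using odd_iff_zero_in_vals[OF assms] by simp
  thus ?thesis
    using assms dominated_append_one unfolding Lucas_def partitions_def
    by (auto simp: odd_mults_add_new)
qed

lemma Lucas_add_two_ones:
  assumes "la \<in> Lucas n" "odd n"
  shows "add_mset 1 (add_mset 1 la) \<in> Lucas (n + 2)"
proof -
  have "0 \<in># vals la"
    using odd_iff_zero_in_vals[OF assms(1)] assms(2) by simp
  thus ?thesis
    using assms dominated_append_one unfolding Lucas_def partitions_def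
    by (auto simp: odd_mults_add_twice)
qed

text \<open>The case distinction is on the number of odd parts, which is odd. All of them except possibly
  the dominating part are ones. If there are at least three, two ones can be removed and an odd
  number of odd parts remains. If there is only one, it is a removable one or the dominating part.\<close>

lemma Lucas_odd_cases:
  assumes "la \<in> Lucas n" "odd n"
  obtains (one) "la = {#1#}" | (three) "la = {#3#}"
  | (single) mu where "la = add_mset 1 mu" "mu \<in> Lucas (n - 1)"
  | (pair) mu where "la = add_mset 1 (add_mset 1 mu)" "mu \<in> Lucas (n - 2)"
proof -
  have pos: "\<forall>x\<in>#la. x > 0" and sum: "\<Sum>\<^sub># la = n"
    and om: "odd_mults (vals la)" and dom: "dominated la"
    using assms unfolding Lucas_def partitions_def by auto
  obtain c k mu where la: "la = add_mset (c * 2 ^ k) mu" and c: "c = 1 \<or> c = 3"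
    and mu: "\<forall>x\<in>#mu. \<exists>j\<le>k. x = 2 ^ j"
    using dom unfolding dominated_def by blast
  have count: "count (vals la) 0 = count mu 1 + (if k = 0 then 1 else 0)"
    using count_vals_zero_powers[OF mu] multiplicity_two_dominating[OF c, of k] by (auto simp: la)
  have odd: "odd (count (vals la) 0)"
    using odd_sum_mset_iff_odd_count[OF pos] sum assms(2) by simp
  have dom_sub: "dominated (add_mset (c * 2 ^ k) nu)" if "nu \<subseteq># mu" for nu
    unfolding dominated_def using c mu mset_subset_eqD[OF that] by blast
  show thesis
  proof (cases "count (vals la) 0 = 1")
    case one_odd: True
    show thesis
    proof (cases "k = 0")
      case True
      \<comment> \<open>An odd dominating part leaves only ones as the other parts, and here there are none.\<close>
      have "x = 1" if "x \<in># mu" for x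
        using mu that True by auto
      moreover have "1 \<notin># mu"
        using count one_odd True by (simp add: not_in_iff)
      ultimately have "mu = {#}"
        by (metis multiset_nonemptyE)
      thus thesis using one three c la True by auto
    next
      case False
      hence "1 \<in># mu"
        using count one_odd by (metis add.right_neutral count_eq_zero_iff zero_neq_one)
      then obtain nu where nu: "mu = add_mset 1 nu" by (metis multi_member_split)
      let ?rest = "add_mset (c * 2 ^ k) nu"
      have la': "la = add_mset 1 ?rest" using la nu by (simp add: add_mset_commute)
      have "count (vals ?rest) 0 = 0"
        using one_odd unfolding la' by simp
      hence "0 \<notin># vals ?rest" by (simp only: not_in_iff)
      hence "odd_mults (vals ?rest)"
        using om unfolding la' by (simp add: odd_mults_add_new)
      moreover have "dominated ?rest" using dom_sub[of nu] nu by simp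
      ultimately have "?rest \<in> Lucas (n - 1)"
        using pos sum unfolding la' Lucas_def partitions_def by auto
      thus thesis using single la' by blast
    qed
  next
    case False
    have "t \<ge> 3" if "odd t" "t \<noteq> 1" for t :: nat
      using that by presburger
    with odd False have three_odd: "count (vals la) 0 \<ge> 3" by blast
    hence "2 \<le> count mu 1"
      using count by (auto split: if_splits)
    hence two: "count mu 1 = Suc (Suc (count mu 1 - 2))" by simp
    hence "1 \<in># mu" by (metis Suc_not_Zero not_in_iff)
    then obtain mu' where mu': "mu = add_mset 1 mu'" by (metis multi_member_split)
    have "count mu' 1 = Suc (count mu 1 - 2)" using two unfolding mu' by simp
    hence "1 \<in># mu'" by (metis Suc_not_Zero not_in_iff)
    then obtain nu where nu: "mu = add_mset 1 (add_mset 1 nu)"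
      unfolding mu' by (metis multi_member_split)
    let ?rest = "add_mset (c * 2 ^ k) nu"
    have la': "la = add_mset 1 (add_mset 1 ?rest)"
      using la nu by (simp add: add_mset_commute)
    have "count (vals ?rest) 0 > 0"
      using three_odd unfolding la' by simp
    hence "0 \<in># vals ?rest" by (simp only: count_greater_zero_iff)
    hence "odd_mults (vals ?rest)"
      using om unfolding la' by (simp add: odd_mults_add_twice)
    moreover have "dominated ?rest"
      using dom_sub[of nu] nu subset_mset.order_trans[of nu "add_mset 1 nu" mu] by simp
    ultimately have "?rest \<in> Lucas (n - 2)"
      using pos sum unfolding la' Lucas_def partitions_def by auto
    thus thesis using pair la' by blast
  qed
qed

lemma Lucas_1: "Lucas 1 = {{#1#}}"
proof -
  have "Lucas 0 = {}"
    unfolding Lucas_def partitions_def dominated_def by fastforce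
  hence "la = {#1#}" if "la \<in> Lucas 1" for la
  proof -
    have "odd (1::nat)" and "\<Sum>\<^sub># la = 1"
      using that by (auto simp: Lucas_def partitions_def)
    with that show ?thesis
      by (cases rule: Lucas_odd_cases) (use \<open>Lucas 0 = {}\<close> in auto)
  qed
  moreover have "{#1#} \<in> Lucas 1"
    using dominated_singleton[of 1] by (simp add: Lucas_def partitions_def odd_mults_def)
  ultimately show ?thesis by blast
qed

text \<open>This is the recursion of \<open>SL\<close>, extended down to \<open>m = 1\<close>: starting it from \<open>Lucas 1 = {(1)}\<close>
  gives all of \<open>SL 3\<close> except \<open>(3)\<close>.\<close>

lemma Lucas_odd:
  assumes "m \<ge> 1"
  shows "Lucas (2 * m + 1) = (\<lambda>la. la + {#1#}) ` Lucas (2 * m) \<union>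
    (\<lambda>la. la + {#1, 1#}) ` Lucas (2 * m - 1) \<union> (if m = 1 then {{#3#}} else {})"
    (is "_ = ?R")
proof
  show "Lucas (2 * m + 1) \<subseteq> ?R"
  proof
    fix la assume la: "la \<in> Lucas (2 * m + 1)"
    hence sum: "\<Sum>\<^sub># la = 2 * m + 1" by (simp add: Lucas_def partitions_def)
    have "odd (2 * m + 1)" by simp
    with la show "la \<in> ?R"
    proof (cases rule: Lucas_odd_cases)
      case one
      thus ?thesis using sum assms by simp
    next
      case three
      thus ?thesis using sum by simp
    next
      case single
      thus ?thesis by auto
    next
      case (pair mu)
      hence "la = mu + {#1, 1#}" "mu \<in> Lucas (2 * m - 1)" by simp_all
      thus ?thesis by blast
    qed
  qed
  have "{#3#} \<in> Lucas 3"
    using dominated_singleton[of 3] by (simp add: Lucas_def partitions_def odd_mults_def)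
  moreover have "la + {#1, 1#} \<in> Lucas (2 * m + 1)" if "la \<in> Lucas (2 * m - 1)" for la
    using Lucas_add_two_ones[OF that] assms by simp
  ultimately show "?R \<subseteq> Lucas (2 * m + 1)"
    using Lucas_add_one[of _ m] by auto
qed

lemma SL_eq_Lucas: "n > 1 \<Longrightarrow> SL n = Lucas n"
proof (induction n rule: SL.induct)
  case 2
  show ?case using Lucas_even[of 1] Lucas_1 by (simp add: double_def)
next
  case 3
  have "Lucas 2 = {{#2#}}" using Lucas_even[of 1] Lucas_1 by (simp add: double_def)
  thus ?case using Lucas_odd[of 1] Lucas_1 by (auto simp: add_mset_commute)
next
  case (4 n)
  thus ?case using Lucas_even[of n] by simp
next
  case (5 n)
  thus ?case unfolding SL.simps(5)[OF 5(1)] using Lucas_odd[of n] by simp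
qed simp

theorem theorem9p2:
  fixes n :: nat
  assumes "n > 1"
  shows "SL n = {la \<in> partitions n.
      (\<forall>i\<in>{1..size la}. odd (count_list (val_seq la) (val la i))) \<and>
      (\<forall>i\<in>{1<..size la}. part la i \<in> {2 ^ k | k. True}) \<and>
      part la 1 \<in> {2 ^ k | k. True} \<union> {3 * 2 ^ k | k. True} \<and>
      (\<forall>i\<in>{1..size la}. multiplicity 2 (part la i) \<le> multiplicity 2 (part la 1))}"
proof -
  have "la \<noteq> {#}" if "la \<in> partitions n" for la
    using that assms by (auto simp: partitions_def)
  thus ?thesis
    unfolding SL_eq_Lucas[OF assms] Lucas_def odd_count_list_iff_odd_mults
    using lucas_conditions_iff by blast
qed

end
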